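(* Let $H_1$ and $H_2$ be loopless graphs (parallel edges allowed) with $V(H_1)\cap V(H_2)=\{v_1,v_2\}$ and disjoint edge sets, and let $G=H_1\cup H_2$. For $i=1,2$ let $G_i$ be the graph obtained from $H_i$ by adding one new edge joining $v_1$ and $v_2$. Suppose that $G$, $G_1$, $G_2$ are connected and that for each $G^*\in\{G,G_1,G_2\}$ we have $2|V(G^* )|=|E(G^* )|+2$. Then the graph permanent of $G$ equals the product of the graph permanents of $G_1$ and $G_2$ (modulo $3$).
   Context: Given a graph $H$ with an arbitrary orientation, its signed incidence matrix has rows indexed by vertices and columns by edges, entry $1$ at the tail, $-1$ at the head, $0$ otherwise; deleting the row of a chosen special vertex and stacking $2$ copies vertically gives a $2$DSI matrix. For $|E(H)|=2(|V(H)|-1)$, the graph permanent of $H$ is $\pm\mathrm{Perm}(M)\bmod 3$ for a $2$DSI matrix $M$ of $H$, taken as a residue in $\{0,1\}$; it is independent of the choices made. Here $\mathrm{Perm}(A)=\sum_{\sigma}\prod_i a_{i,\sigma(i)}$. *)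

theory Defs
  imports
    "HOL-Number_Theory.Cong"
    "HOL-Combinatorics.Permutations"
    "Jordan_Normal_Form.Matrix"
begin

record ('v, 'e) mgraph =
  verts :: "'v set"
  edges :: "'e set"
  ends :: "'e \<Rightarrow> 'v set"

text \<open>Finite undirected multigraphs. Distinct edges may have the same set of ends
  (parallel edges); an edge with a single end is a loop. The value of \<open>ends\<close> outside
  \<open>edges\<close> is irrelevant.\<close>

definition multigraph :: "('v, 'e) mgraph \<Rightarrow> bool" where
  "multigraph H \<longleftrightarrow> finite (verts H) \<and> finite (edges H) \<and>
     (\<forall>e\<in>edges H. ends H e \<subseteq> verts H \<and> card (ends H e) \<in> {1, 2})"

definition loopless :: "('v, 'e) mgraph \<Rightarrow> bool" where
  "loopless H \<longleftrightarrow> (\<forall>e\<in>edges H. card (ends H e) \<noteq> 1)"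

definition adjacency :: "('v, 'e) mgraph \<Rightarrow> ('v \<times> 'v) set" where
  "adjacency H = {(u, v). \<exists>e\<in>edges H. ends H e = {u, v}}"

definition connected_mgraph :: "('v, 'e) mgraph \<Rightarrow> bool" where
  "connected_mgraph H \<longleftrightarrow>
     verts H \<noteq> {} \<and> (\<forall>u\<in>verts H. \<forall>v\<in>verts H. (u, v) \<in> (adjacency H)\<^sup>*)"

text \<open>The union is only used for graphs with disjoint edge sets, so that the choice of
  \<open>ends\<close> on common edges does not matter.\<close>

definition graph_union :: "('v, 'e) mgraph \<Rightarrow> ('v, 'e) mgraph \<Rightarrow> ('v, 'e) mgraph" where
  "graph_union H K = \<lparr>verts = verts H \<union> verts K, edges = edges H \<union> edges K,
     ends = (\<lambda>e. if e \<in> edges H then ends H e else ends K e)\<rparr>"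

definition add_edge :: "('v, 'e) mgraph \<Rightarrow> 'e \<Rightarrow> 'v \<Rightarrow> 'v \<Rightarrow> ('v, 'e) mgraph" where
  "add_edge H e u v = H\<lparr>edges := insert e (edges H), ends := (ends H)(e := {u, v})\<rparr>"

definition orientation :: "('v, 'e) mgraph \<Rightarrow> ('e \<Rightarrow> 'v) \<Rightarrow> ('e \<Rightarrow> 'v) \<Rightarrow> bool" where
  "orientation H t h \<longleftrightarrow> (\<forall>e\<in>edges H. ends H e = {t e, h e})"

definition signed_incidence ::
    "('e \<Rightarrow> 'v) \<Rightarrow> ('e \<Rightarrow> 'v) \<Rightarrow> 'v list \<Rightarrow> 'e list \<Rightarrow> int mat" where
  "signed_incidence t h vs es = mat (length vs) (length es)
     (\<lambda>(i, j). if t (es ! j) = vs ! i then 1 else if h (es ! j) = vs ! i then -1 else 0)"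

text \<open>The lists \<open>vs\<close> and \<open>es\<close> order the rows and the columns of the signed incidence
  matrix; dropping the special vertex \<open>s\<close> from \<open>vs\<close> deletes its row.\<close>

definition is_2DSI :: "('v, 'e) mgraph \<Rightarrow> int mat \<Rightarrow> bool" where
  "is_2DSI H M \<longleftrightarrow> (\<exists>t h vs es s. orientation H t h \<and>
     distinct vs \<and> set vs = verts H \<and> distinct es \<and> set es = edges H \<and> s \<in> verts H \<and>
     (let A = signed_incidence t h (remove1 s vs) es in M = A @\<^sub>r A))"

definition permanent :: "'a :: comm_ring_1 mat \<Rightarrow> 'a" where
  "permanent A = (if dim_row A = dim_col A
     then \<Sum>p | p permutes {0..<dim_row A}. \<Prod>i = 0..<dim_row A. A $$ (i, p i) else 0)"

text \<open>The common residue in \<open>{0, 1}\<close>, up to sign and modulo 3, of the permanents of all 2DSI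
  matrices of \<open>H\<close>. Meaningful for loopless \<open>H\<close> with
  \<open>card (edges H) = 2 * (card (verts H) - 1)\<close>, which makes these matrices square.\<close>

definition graph_permanent :: "('v, 'e) mgraph \<Rightarrow> int" where
  "graph_permanent H = (THE r. r \<in> {0, 1} \<and>
     (\<forall>M. is_2DSI H M \<longrightarrow> [permanent M = r] (mod 3) \<or> [permanent M = - r] (mod 3)))"

end

theory Submission
  imports Defs "HOL-Library.Numeral_Type"
begin

text \<open>Modulo 3, Ryser's formula turns the permanent of a 2DSI matrix of \<open>H\<close> into the sum over
  all potentials \<open>x : V(H) \<rightarrow> F\<^sub>3\<close> vanishing at the special vertex of
  the product over the edges \<open>e\<close> of the potential differences along \<open>e\<close>. Take \<open>v\<^sub>1\<close> as
  special vertex and let \<open>F\<^sub>i(a)\<close> be the part of the sum for \<open>H\<^sub>i\<close> with \<open>x(v\<^sub>2) = a\<close>.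
  Since \<open>H\<^sub>i\<close> has an odd number of edges, \<open>F\<^sub>i\<close> is an odd function on \<open>F\<^sub>3\<close>, determined by
  \<open>F\<^sub>i(1)\<close>. The sum for \<open>G\<^sub>i\<close> is \<open>- \<Sum>\<^sub>a a F\<^sub>i(a) = F\<^sub>i(1)\<close> and the sum for \<open>G\<close> is
  \<open>\<Sum>\<^sub>a F\<^sub>1(a) F\<^sub>2(a) = - F\<^sub>1(1) F\<^sub>2(1)\<close>. The graph permanent is the square of the sum.\<close>

section \<open>Expansion of products of linear forms and Ryser's formula\<close>

text \<open>Multiplying out chooses an index \<open>f j\<close> in each factor; for fixed
  \<open>f\<close> the sum over \<open>y\<close> then factors over the coordinates, and coordinate
  \<open>i\<close> sees only how often \<open>f\<close> chose it. The coefficient set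
  \<open>C\<close> and its weights \<open>w\<close> thus enter only through the moments
  \<open>\<Sum>c\<in>C. w c * v c ^ d\<close>.\<close>

lemma sum_prod_linear_forms:
  fixes b :: "'i \<Rightarrow> 'j \<Rightarrow> 'a::comm_ring_1"
  assumes I: "finite I" and J: "finite J" and C: "finite C"
  shows "(\<Sum>y\<in>I \<rightarrow>\<^sub>E C. (\<Prod>i\<in>I. w (y i)) * (\<Prod>j\<in>J. \<Sum>i\<in>I. v (y i) * b i j)) =
    (\<Sum>f\<in>J \<rightarrow>\<^sub>E I. (\<Prod>j\<in>J. b (f j) j) * (\<Prod>i\<in>I. \<Sum>c\<in>C. w c * v c ^ card {j\<in>J. f j = i}))"
proof -
  have pw: "(\<Prod>j\<in>J. v (y (f j))) = (\<Prod>i\<in>I. v (y i) ^ card {j\<in>J. f j = i})"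
    if "f \<in> J \<rightarrow>\<^sub>E I" for y :: "'i \<Rightarrow> 'b" and f
  proof -
    have "(\<Prod>j\<in>J. v (y (f j))) = (\<Prod>i\<in>I. \<Prod>j\<in>{j\<in>J. f j = i}. v (y (f j)))"
      by (rule prod.group[symmetric]) (use I J that in auto)
    then show ?thesis by simp
  qed
  have "(\<Sum>y\<in>I \<rightarrow>\<^sub>E C. (\<Prod>i\<in>I. w (y i)) * (\<Prod>j\<in>J. \<Sum>i\<in>I. v (y i) * b i j)) =
     (\<Sum>y\<in>I \<rightarrow>\<^sub>E C. \<Sum>f\<in>J \<rightarrow>\<^sub>E I. (\<Prod>i\<in>I. w (y i)) * (\<Prod>j\<in>J. v (y (f j)) * b (f j) j))"
    using I J by (simp add: prod_sum_PiE sum_distrib_left)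
  also have "\<dots> = (\<Sum>f\<in>J \<rightarrow>\<^sub>E I. \<Sum>y\<in>I \<rightarrow>\<^sub>E C. (\<Prod>i\<in>I. w (y i)) * (\<Prod>j\<in>J. v (y (f j)) * b (f j) j))"
    by (rule sum.swap)
  also have "\<dots> = (\<Sum>f\<in>J \<rightarrow>\<^sub>E I. (\<Prod>j\<in>J. b (f j) j) *
      (\<Sum>y\<in>I \<rightarrow>\<^sub>E C. \<Prod>i\<in>I. w (y i) * v (y i) ^ card {j\<in>J. f j = i}))"
    unfolding sum_distrib_left
    by (intro sum.cong refl) (simp add: prod.distrib pw mult_ac)
  also have "\<dots> = (\<Sum>f\<in>J \<rightarrow>\<^sub>E I. (\<Prod>j\<in>J. b (f j) j) * (\<Prod>i\<in>I. \<Sum>c\<in>C. w c * v c ^ card {j\<in>J. f j = i}))"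
    using I C by (simp add: prod_sum_PiE)
  finally show ?thesis .
qed

lemma sum_surjections_eq_sum_permutations:
  fixes b :: "nat \<Rightarrow> nat \<Rightarrow> 'a::comm_ring_1"
  shows "(\<Sum>f\<in>{f \<in> {..<n} \<rightarrow>\<^sub>E {..<n}. f ` {..<n} = {..<n}}. \<Prod>j<n. b (f j) j) =
    (\<Sum>p | p permutes {..<n}. \<Prod>i<n. b i (p i))"
proof -
  have "(\<Sum>f\<in>{f \<in> {..<n} \<rightarrow>\<^sub>E {..<n}. f ` {..<n} = {..<n}}. \<Prod>j<n. b (f j) j) =
      (\<Sum>p | p permutes {..<n}. \<Prod>j<n. b (p j) j)"
  \<comment> \<open>Outside \<open>{..<n}\<close> an extensional function is
    \<open>undefined\<close> and a permutation is the identity; the witnesses exchange these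
    defaults.\<close>
  proof (rule sum.reindex_bij_witness[where i = "\<lambda>p. restrict p {..<n}"
        and j = "\<lambda>f j. if j < n then f j else j"], goal_cases)
    case (2 f)
    have bij: "bij_betw f {..<n} {..<n}"
      using 2 by (simp add: bij_betw_def finite_surj_inj)
    have "bij_betw (\<lambda>j. if j < n then f j else j) {..<n} {..<n}"
      using bij by (rule bij_betw_cong[THEN iffD1, rotated]) simp
    then show ?case by (auto intro!: bij_imp_permutes split: if_splits)
  next
    case (4 p)
    then show ?case by (auto simp: permutes_image permutes_in_image PiE_def extensional_def Pi_def
          dest: permutes_in_image[of p "{..<n}"] permutes_image)
  qed (auto simp: permutes_def PiE_def extensional_def fun_eq_iff)
  \<comment> \<open>So far \<open>p\<close> sends columns to rows; passing to the inverse makes it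
    send rows to columns, as in the definition of the permanent.\<close>
  also have "\<dots> = (\<Sum>p | p permutes {..<n}. \<Prod>j<n. b (inv_into UNIV p j) j)"
    by (rule sum_permutations_inverse)
  also have "\<dots> = (\<Sum>p | p permutes {..<n}. \<Prod>i<n. b i (p i))"
  proof (rule sum.cong[OF refl])
    fix p assume "p \<in> {p. p permutes {..<n}}"
    then have p: "p permutes {..<n}" by simp
    show "(\<Prod>j<n. b (inv_into UNIV p j) j) = (\<Prod>i<n. b i (p i))"
      using prod.permute[OF p, of "\<lambda>j. b (inv_into UNIV p j) j"] permutes_inverses(2)[OF p]
      by (simp add: o_def)
  qed
  finally show ?thesis .
qed

text \<open>Ryser's formula, with a boolean vector selecting the set of rows.\<close>

lemma ryser:
  fixes b :: "nat \<Rightarrow> nat \<Rightarrow> 'a::comm_ring_1"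
  shows "(\<Sum>p | p permutes {..<n}. \<Prod>i<n. b i (p i)) =
    (\<Sum>y\<in>{..<n} \<rightarrow>\<^sub>E UNIV. (\<Prod>i<n. if y i then 1 else -1) *
      (\<Prod>j<n. \<Sum>i<n. of_bool (y i) * b i j))"
proof -
  have "(\<Sum>y\<in>{..<n} \<rightarrow>\<^sub>E UNIV. (\<Prod>i<n. if y i then 1 else -1) *
      (\<Prod>j<n. \<Sum>i<n. of_bool (y i) * b i j)) =
    (\<Sum>f\<in>{..<n} \<rightarrow>\<^sub>E {..<n}. (\<Prod>j<n. b (f j) j) *
      (\<Prod>i<n. \<Sum>c\<in>UNIV. (if c then 1 else -1) * of_bool c ^ card {j\<in>{..<n}. f j = i}))"
    by (rule sum_prod_linear_forms) auto
  also have "\<dots> = (\<Sum>f\<in>{..<n} \<rightarrow>\<^sub>E {..<n}.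
      if f ` {..<n} = {..<n} then \<Prod>j<n. b (f j) j else 0)"
  proof (rule sum.cong[OF refl])
    fix f assume f: "f \<in> {..<n} \<rightarrow>\<^sub>E {..<n}"
    \<comment> \<open>The moment of exponent \<open>d\<close> is \<open>1 - 0 ^ d\<close>, which
      vanishes exactly for \<open>d = 0\<close>. Hence only those \<open>f\<close> survive that
      choose every row.\<close>
    have "(\<Sum>c\<in>UNIV. (if c then 1 else -1) * of_bool c ^ card {j\<in>{..<n}. f j = i}) =
        (if i \<in> f ` {..<n} then 1 else 0 :: 'a)" for i
      by (auto simp: UNIV_bool power_0_left)
    moreover have "f ` {..<n} = {..<n} \<longleftrightarrow> (\<forall>i\<in>{..<n}. i \<in> f ` {..<n})"
      using f by auto
    moreover have "(\<Prod>i<n. if i \<in> f ` {..<n} then 1 else 0 :: 'a) =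
        (if \<forall>i\<in>{..<n}. i \<in> f ` {..<n} then 1 else 0)"
    proof (cases "\<forall>i\<in>{..<n}. i \<in> f ` {..<n}")
      case False
      then have "(\<Prod>i<n. if i \<in> f ` {..<n} then 1 else 0 :: 'a) = 0"
        by (intro prod_zero) auto
      then show ?thesis using False by (simp only: if_False)
    qed simp
    ultimately show "(\<Prod>j<n. b (f j) j) *
      (\<Prod>i<n. \<Sum>c\<in>UNIV. (if c then 1 else -1) * of_bool c ^ card {j\<in>{..<n}. f j = i}) =
      (if f ` {..<n} = {..<n} then \<Prod>j<n. b (f j) j else 0)"
      by (simp only: mult_1_right mult_zero_right split: if_split) blast
  qed
  also have "\<dots> = (\<Sum>f\<in>{f \<in> {..<n} \<rightarrow>\<^sub>E {..<n}. f ` {..<n} = {..<n}}. \<Prod>j<n. b (f j) j)"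
    by (rule sum.inter_filter[symmetric]) (simp add: finite_PiE)
  finally show ?thesis by (simp add: sum_surjections_eq_sum_permutations)
qed

section \<open>Arithmetic modulo 3 and permanents of stacked matrices\<close>

lemma UNIV_mod3: "(UNIV :: 3 set) = {0, 1, 2}"
proof -
  have "card {0, 1, 2 :: 3} = CARD(3)" by simp
  then show ?thesis by (metis card_subset_eq finite_UNIV subset_UNIV finite)
qed

lemma mod3_cases: "x = 0 \<or> x = 1 \<or> x = (2 :: 3)"
  using UNIV_mod3 by auto

lemma of_int_mod3_eq_iff: "(of_int a :: 3) = of_int b \<longleftrightarrow> [a = b] (mod 3)"
  by (simp add: of_int_eq_iff_cong_CHAR)

lemma minus_2_mod3: "- 2 = (1 :: 3)"
  by simp

text \<open>Ryser's formula for the stacked matrix has the weights \<open>1, -2, 1\<close> on the coefficients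
  \<open>0, 1, 2\<close> of each row; modulo 3 these weights are all 1.\<close>

lemma permanent_doubled_rows_mod3:
  fixes a :: "nat \<Rightarrow> nat \<Rightarrow> 3"
  shows "(\<Sum>p | p permutes {..<2*k}. \<Prod>i<2*k. a (i mod k) (p i)) =
    (\<Sum>x\<in>{..<k} \<rightarrow>\<^sub>E UNIV. \<Prod>j<2*k. \<Sum>i<k. x i * a i j)"
proof -
  define w :: "bool \<Rightarrow> 3" where "w c = (if c then 1 else -1)" for c
  have split: "(\<Prod>i<2*k. g i) = (\<Prod>i<k. g i * g (i + k))"
    "(\<Sum>i<2*k. g i) = (\<Sum>i<k. g i + g (i + k))" for g :: "nat \<Rightarrow> 3"
  proof -
    have "{..<2*k} = {..<k} \<union> (\<lambda>i. i + k) ` {..<k}" (is "_ = _ \<union> ?T")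
    proof -
      have "x \<in> ?T" if "x < 2 * k" "\<not> x < k" for x
        using that by (intro image_eqI[of _ _ "x - k"]) auto
      then show ?thesis by auto
    qed
    moreover have "{..<k} \<inter> ?T = {}" "inj_on (\<lambda>i. i + k) {..<k}" by auto
    ultimately show "(\<Prod>i<2*k. g i) = (\<Prod>i<k. g i * g (i + k))"
      "(\<Sum>i<2*k. g i) = (\<Sum>i<k. g i + g (i + k))"
      by (simp_all add: prod.union_disjoint sum.union_disjoint prod.reindex sum.reindex
          prod.distrib sum.distrib)
  qed
  have "(\<Sum>p | p permutes {..<2*k}. \<Prod>i<2*k. a (i mod k) (p i)) =
    (\<Sum>y\<in>{..<2*k} \<rightarrow>\<^sub>E UNIV. (\<Prod>i<2*k. w (y i)) *
      (\<Prod>j<2*k. \<Sum>i<2*k. of_bool (y i) * a (i mod k) j))"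
    unfolding w_def by (rule ryser)
  \<comment> \<open>The selections of the two copies of row \<open>i\<close> are merged into the
    pair \<open>z i\<close>, so that the row itself gets the coefficient 0, 1 or 2.\<close>
  also have "\<dots> = (\<Sum>z\<in>{..<k} \<rightarrow>\<^sub>E UNIV. (\<Prod>i<k. w (fst (z i)) * w (snd (z i))) *
      (\<Prod>j<2*k. \<Sum>i<k. (of_bool (fst (z i)) + of_bool (snd (z i))) * a i j))"
    by (rule sum.reindex_bij_witness[where j = "\<lambda>y. \<lambda>i\<in>{..<k}. (y i, y (i + k))" and
        i = "\<lambda>z. \<lambda>i\<in>{..<2*k}. if i < k then fst (z i) else snd (z (i - k))"])
      (auto simp: split distrib_right PiE_def extensional_def fun_eq_iff intro!: sum.cong prod.cong)
  \<comment> \<open>After expansion the weights matter only through their moments. These agree with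
    the power sums over all of \<open>3\<close>, so the weights can be exchanged and the expansion
    folded back.\<close>
  also have "\<dots> = (\<Sum>f\<in>{..<2*k} \<rightarrow>\<^sub>E {..<k}. (\<Prod>j<2*k. a (f j) j) *
      (\<Prod>i<k. \<Sum>c\<in>UNIV. (w (fst c) * w (snd c)) *
        (of_bool (fst c) + of_bool (snd c)) ^ card {j\<in>{..<2*k}. f j = i}))"
    by (rule sum_prod_linear_forms[where w = "\<lambda>c. w (fst c) * w (snd c)" and
        v = "\<lambda>c. of_bool (fst c) + of_bool (snd c)"]) auto
  also have "\<dots> = (\<Sum>f\<in>{..<2*k} \<rightarrow>\<^sub>E {..<k}. (\<Prod>j<2*k. a (f j) j) *
      (\<Prod>i<k. \<Sum>c\<in>UNIV. 1 * c ^ card {j\<in>{..<2*k}. f j = i}))"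
  proof -
    have "(\<Sum>c\<in>UNIV. (w (fst c) * w (snd c)) * (of_bool (fst c) + of_bool (snd c)) ^ d) =
        (\<Sum>c\<in>UNIV. 1 * c ^ d)" for d
    proof -
      have "(\<Sum>c\<in>UNIV. g c) = g (True, True) + g (True, False) + g (False, True) + g (False, False)"
        for g :: "bool \<times> bool \<Rightarrow> 3"
        by (simp add: UNIV_bool add_ac flip: UNIV_Times_UNIV)
      then have "(\<Sum>c\<in>UNIV. (w (fst c) * w (snd c)) * (of_bool (fst c) + of_bool (snd c)) ^ d) =
          2 ^ d + (-2) + 0 ^ d"
        by (simp add: w_def)
      also have "\<dots> = (\<Sum>c\<in>{0, 1, 2}. 1 * c ^ d)"
        by (simp only: minus_2_mod3) simp
      finally show ?thesis by (simp only: UNIV_mod3)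
    qed
    then show ?thesis by simp
  qed
  also have "\<dots> = (\<Sum>x\<in>{..<k} \<rightarrow>\<^sub>E UNIV. (\<Prod>i<k. 1) * (\<Prod>j<2*k. \<Sum>i<k. x i * a i j))"
    by (rule sum_prod_linear_forms[where w = "\<lambda>_. 1" and v = "\<lambda>c. c", symmetric]) auto
  finally show ?thesis by simp
qed

section \<open>Potential sums and their relation to 2DSI matrices\<close>

text \<open>Potentials are extensional, so each is counted once. The predicate \<open>P\<close>
  serves both to fix 0 at a special vertex and to prescribe a second value.\<close>

definition potential_sum ::
    "('v, 'e) mgraph \<Rightarrow> ('e \<Rightarrow> 'v) \<Rightarrow> ('e \<Rightarrow> 'v) \<Rightarrow> (('v \<Rightarrow> 3) \<Rightarrow> bool) \<Rightarrow> 3" where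
  "potential_sum H t h P =
    (\<Sum>x\<in>{x \<in> verts H \<rightarrow>\<^sub>E UNIV. P x}. \<Prod>e\<in>edges H. x (t e) - x (h e))"

text \<open>A coefficient vector on the rows is a potential on the vertices other than
  \<open>s\<close>. Since the column of an edge has 1 at the tail and -1 at the head, its linear
  form is the potential difference along that edge.\<close>

lemma permanent_2DSI_mod3:
  assumes "is_2DSI H M" and "loopless H" and "multigraph H"
    and card: "2 * card (verts H) = card (edges H) + 2"
  obtains t h s where "orientation H t h" "s \<in> verts H"
    "of_int (permanent M) = potential_sum H t h (\<lambda>x. x s = 0)"
proof -
  from assms(1) obtain t h vs es s where or: "orientation H t h" and
    vs: "distinct vs" "set vs = verts H" and es: "distinct es" "set es = edges H" and
    s: "s \<in> verts H" and
    M: "M = signed_incidence t h (remove1 s vs) es @\<^sub>r signed_incidence t h (remove1 s vs) es"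
    unfolding is_2DSI_def Let_def by blast
  define ws where "ws = remove1 s vs"
  define k where "k = length ws"
  define a :: "nat \<Rightarrow> nat \<Rightarrow> 3" where "a i j = of_int (signed_incidence t h ws es $$ (i, j))" for i j
  have ws: "distinct ws" "set ws = verts H - {s}"
    using vs by (simp_all add: ws_def)
  have len: "length es = 2 * k"
    using card s vs distinct_card[OF vs(1)] distinct_card[OF es(1)] es(2)
    by (simp add: k_def ws_def length_remove1)
  have dim: "signed_incidence t h ws es \<in> carrier_mat k (2 * k)"
    by (simp add: signed_incidence_def k_def len)
  have fin: "finite (verts H)" using vs(2) by (metis finite_set)
  have M': "M = signed_incidence t h ws es @\<^sub>r signed_incidence t h ws es"
    using M by (simp add: ws_def)
  have dimM: "M \<in> carrier_mat (2 * k) (2 * k)"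
    unfolding M' using carrier_append_rows[OF dim dim] by (simp add: mult_2)
  have entry: "of_int (M $$ (i, j)) = a (i mod k) j" if "i < 2 * k" "j < 2 * k" for i j
  proof (cases "i < k")
    case True
    then show ?thesis using that dim unfolding M' a_def
      by (simp add: append_rows_def)
  next
    case False
    then have "i mod k = i - k" using that by (simp add: mod_if)
    then show ?thesis using that dim False unfolding M' a_def
      by (simp add: append_rows_def)
  qed
  have "(of_int (permanent M) :: 3) = (\<Sum>p | p permutes {..<2*k}. \<Prod>i<2*k. a (i mod k) (p i))"
  proof -
    have "permanent M = (\<Sum>p | p permutes {..<2*k}. \<Prod>i<2*k. M $$ (i, p i))"
      using dimM by (simp add: permanent_def lessThan_atLeast0)
    moreover have "(\<Prod>i<2*k. of_int (M $$ (i, p i))) = (\<Prod>i<2*k. a (i mod k) (p i))"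
      if "p permutes {..<2*k}" for p
      using permutes_in_image[OF that] by (intro prod.cong) (auto simp: entry)
    ultimately show ?thesis by (simp add: of_int_sum of_int_prod)
  qed
  also have "\<dots> = (\<Sum>x\<in>{..<k} \<rightarrow>\<^sub>E UNIV. \<Prod>j<2*k. \<Sum>i<k. x i * a i j)"
    by (rule permanent_doubled_rows_mod3)
  also have "\<dots> = potential_sum H t h (\<lambda>x. x s = 0)"
    unfolding potential_sum_def
  \<comment> \<open>Row positions become vertices through \<open>ws\<close>; the deleted row of
    \<open>s\<close> corresponds to potential 0.\<close>
  proof (rule sum.reindex_bij_witness[symmetric, where j = "\<lambda>x. \<lambda>i\<in>{..<k}. x (ws ! i)" and
        i = "\<lambda>y. \<lambda>v\<in>verts H. if v = s then 0 else y (the_inv_into {..<k} ((!) ws) v)"], goal_cases)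
    case (1 x)
    have bij: "bij_betw ((!) ws) {..<k} (verts H - {s})"
      by (rule bij_betw_nth) (simp_all add: ws k_def)
    have "x (ws ! the_inv_into {..<k} ((!) ws) v) = x v" if "v \<in> verts H" "v \<noteq> s" for v
      using f_the_inv_into_f_bij_betw[OF bij, of v] that by simp
    moreover have "the_inv_into {..<k} ((!) ws) v < k" if "v \<in> verts H" "v \<noteq> s" for v
      using bij_betw_the_inv_into[OF bij] that by (auto simp: bij_betw_def)
    ultimately show ?case using 1 by (auto simp: fun_eq_iff PiE_def extensional_def)
  next
    case (3 y)
    have bij: "bij_betw ((!) ws) {..<k} (verts H - {s})"
      by (rule bij_betw_nth) (simp_all add: ws k_def)
    have "ws ! i \<in> verts H - {s}" "the_inv_into {..<k} ((!) ws) (ws ! i) = i" if "i < k" for i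
      using bij that by (auto simp: bij_betw_def the_inv_into_f_f)
    then show ?case using 3 by (auto simp: fun_eq_iff PiE_def extensional_def)
  next
    case (5 x)
    have bij: "bij_betw ((!) ws) {..<k} (verts H - {s})"
      by (rule bij_betw_nth) (simp_all add: ws k_def)
    have "(\<Sum>i<k. (\<lambda>i\<in>{..<k}. x (ws ! i)) i * a i j) = x (t (es ! j)) - x (h (es ! j))"
      if "j < 2 * k" for j
    proof -
      let ?e = "es ! j"
      have e: "?e \<in> edges H" using that es(2) len by (metis nth_mem)
      have ends: "ends H ?e = {t ?e, h ?e}" using or e by (simp add: orientation_def)
      have th: "t ?e \<noteq> h ?e" "t ?e \<in> verts H" "h ?e \<in> verts H"
        using assms(2,3) e ends by (auto simp: loopless_def multigraph_def)
      have "(\<Sum>i<k. (\<lambda>i\<in>{..<k}. x (ws ! i)) i * a i j) =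
          (\<Sum>i<k. x (ws ! i) * (if t ?e = ws ! i then 1 else if h ?e = ws ! i then -1 else 0))"
        using that by (intro sum.cong) (auto simp: a_def signed_incidence_def k_def len)
      also have "\<dots> = (\<Sum>v\<in>verts H - {s}. x v * (if t ?e = v then 1 else if h ?e = v then -1 else 0))"
        using sum.reindex_bij_betw[OF bij] .
      \<comment> \<open>The row of \<open>s\<close> can be restored because
        \<open>x s = 0\<close>.\<close>
      also have "\<dots> = (\<Sum>v\<in>verts H. x v * (if t ?e = v then 1 else if h ?e = v then -1 else 0))"
        using 5 by (intro sum.mono_neutral_left) (auto simp: fin)
      \<comment> \<open>Distinct ends are essential: for a loop the matrix entry would be 1, but the
        difference 0.\<close>
      also have "\<dots> = (\<Sum>v\<in>verts H. (if t ?e = v then x v else 0) - (if h ?e = v then x v else 0))"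
        using th(1) by (intro sum.cong) auto
      also have "\<dots> = x (t ?e) - x (h ?e)"
        using th fin by (simp add: sum_subtractf)
      finally show ?thesis .
    qed
    then have "(\<Prod>j<2*k. \<Sum>i<k. (\<lambda>i\<in>{..<k}. x (ws ! i)) i * a i j) =
        (\<Prod>j<2*k. x (t (es ! j)) - x (h (es ! j)))"
      by (intro prod.cong) auto
    also have "\<dots> = (\<Prod>e\<in>edges H. x (t e) - x (h e))"
      by (rule prod.reindex_bij_betw) (rule bij_betw_nth, simp_all add: es len)
    finally show ?case .
  qed (simp_all add: s)
  finally show thesis using that or s by blast
qed

section \<open>Independence of choices, and the graph permanent as a square\<close>

text \<open>Reversing an edge negates one factor in every product, so the whole sum changes by a
  sign that does not depend on the potential; squaring removes it.\<close>

lemma potential_sum_orientation: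
  assumes "orientation H t h" "orientation H t' h'"
  shows "(potential_sum H t' h' P)\<^sup>2 = (potential_sum H t h P)\<^sup>2"
proof -
  define c :: 3 where "c = (\<Prod>e\<in>edges H. if t' e = t e then 1 else -1)"
  have c: "c\<^sup>2 = 1"
    unfolding c_def prod_power_distrib by (rule prod.neutral) auto
  have "t' e = t e \<and> h' e = h e \<or> t' e = h e \<and> h' e = t e" if "e \<in> edges H" for e
    using assms that by (auto simp: orientation_def doubleton_eq_iff)
  then have eq: "x (t' e) - x (h' e) = (if t' e = t e then 1 else -1) * (x (t e) - x (h e))"
    if "e \<in> edges H" for e and x :: "_ \<Rightarrow> 3"
    using that by fastforce
  have "potential_sum H t' h' P = c * potential_sum H t h P"
    unfolding potential_sum_def c_def sum_distrib_left prod.distrib[symmetric]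
    by (intro sum.cong prod.cong refl eq)
  then show ?thesis by (simp add: power_mult_distrib c)
qed

text \<open>Subtracting a constant from a potential preserves all differences, so the zero can be
  moved to any vertex.\<close>

lemma potential_sum_translate:
  assumes "multigraph H" "orientation H t h" "u \<in> verts H" "v \<in> verts H"
  shows "potential_sum H t h (\<lambda>x. x u = 0) = potential_sum H t h (\<lambda>x. x v = 0)"
proof -
  have th: "t e \<in> verts H" "h e \<in> verts H" if "e \<in> edges H" for e
    using assms(1,2) that by (auto simp: multigraph_def orientation_def)
  show ?thesis
    unfolding potential_sum_def
    by (rule sum.reindex_bij_witness[where j = "\<lambda>x. \<lambda>w\<in>verts H. x w - x v" and
          i = "\<lambda>x. \<lambda>w\<in>verts H. x w - x u"])
      (use assms(3,4) th in \<open>auto simp: fun_eq_iff PiE_def extensional_def intro!: prod.cong\<close>)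
qed

text \<open>This turns the sign ambiguity of the graph permanent into an equation between squares,
  and a square in \<open>3\<close> is itself 0 or 1.\<close>

lemma mod3_eq_or_uminus_iff: "x = y \<or> x = - y \<longleftrightarrow> x\<^sup>2 = (y\<^sup>2 :: 3)"
  using mod3_cases[of x] mod3_cases[of y] by auto

lemma ex_orientation:
  assumes "multigraph H"
  obtains t h where "orientation H t h"
proof -
  have "\<exists>p. ends H e = {fst p, snd p}" if "e \<in> edges H" for e
  proof -
    have "card (ends H e) = 1 \<or> card (ends H e) = 2"
      using assms that by (auto simp: multigraph_def)
    then obtain u v where "ends H e = {u, v}"
      by (metis card_1_singletonE card_2_iff insert_absorb2)
    then show ?thesis by (intro exI[of _ "(u, v)"]) simp
  qed
  then obtain p where "\<And>e. e \<in> edges H \<Longrightarrow> ends H e = {fst (p e), snd (p e)}"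
    by metis
  then show thesis using that[of "fst \<circ> p" "snd \<circ> p"] by (simp add: orientation_def)
qed

text \<open>By the two invariance lemmas the permanents of all 2DSI matrices have the same square in
  \<open>3\<close>, and this square is the residue sought.\<close>

lemma graph_permanent_mod3:
  assumes "multigraph H" "loopless H" "2 * card (verts H) = card (edges H) + 2"
    and or: "orientation H t h" and u: "u \<in> verts H"
  shows "(of_int (graph_permanent H) :: 3) = (potential_sum H t h (\<lambda>x. x u = 0))\<^sup>2"
proof -
  define S where "S = potential_sum H t h (\<lambda>x. x u = 0)"
  define r :: int where "r = (if S = 0 then 0 else 1)"
  have r: "of_int r = S\<^sup>2" "r \<in> {0, 1}"
    using mod3_cases[of S] by (auto simp: r_def)
  have iff: "[permanent M = q] (mod 3) \<or> [permanent M = - q] (mod 3) \<longleftrightarrow> q = r"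
    if M: "is_2DSI H M" and q: "q \<in> {0, 1}" for M q
  proof -
    obtain t' h' s where s: "orientation H t' h'" "s \<in> verts H"
      "of_int (permanent M) = potential_sum H t' h' (\<lambda>x. x s = 0)"
      using permanent_2DSI_mod3[OF M assms(2,1,3)] by blast
    have "(of_int (permanent M) :: 3)\<^sup>2 = S\<^sup>2"
      unfolding s(3) S_def
      using potential_sum_orientation[OF or s(1)] potential_sum_translate[OF assms(1) or s(2) u]
      by simp
    then have "of_int (permanent M) = (of_int q :: 3) \<or> of_int (permanent M) = - (of_int q :: 3) \<longleftrightarrow>
        (of_int r :: 3) = (of_int q)\<^sup>2"
      by (simp only: mod3_eq_or_uminus_iff r(1))
    also have "\<dots> \<longleftrightarrow> q = r"
      using q r(2) by auto
    finally show ?thesis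
      by (simp flip: of_int_mod3_eq_iff)
  qed
  \<comment> \<open>Uniqueness of the residue needs some matrix; otherwise both 0 and 1 would
    satisfy the description vacuously.\<close>
  obtain M where "is_2DSI H M"
  proof -
    have "finite (verts H)" "finite (edges H)"
      using assms(1) by (simp_all add: multigraph_def)
    then obtain vs es where "set vs = verts H" "distinct vs" "set es = edges H" "distinct es"
      by (metis finite_distinct_list)
    then have "is_2DSI H (signed_incidence t h (remove1 u vs) es @\<^sub>r signed_incidence t h (remove1 u vs) es)"
      using or u unfolding is_2DSI_def Let_def by (intro exI conjI) (rule refl | assumption)+
    then show thesis by (rule that)
  qed
  then have "graph_permanent H = r"
    unfolding graph_permanent_def
  proof (intro the_equality conjI allI impI)
    show "r \<in> {0, 1}" by (rule r(2))
    show "[permanent N = r] (mod 3) \<or> [permanent N = - r] (mod 3)" if "is_2DSI H N" for N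
      using iff[OF that r(2)] by simp
    show "q = r" if "q \<in> {0, 1} \<and>
        (\<forall>M. is_2DSI H M \<longrightarrow> [permanent M = q] (mod 3) \<or> [permanent M = - q] (mod 3))" for q
      using that iff[OF \<open>is_2DSI H M\<close>, of q] \<open>is_2DSI H M\<close> by simp
  qed
  then show ?thesis using r(1) by (simp add: S_def)
qed

section \<open>Potential sums under negation, edge addition and union\<close>

text \<open>Negating a potential negates the factor of every edge, keeps the value 0 at
  \<open>u\<close> and exchanges the values \<open>a\<close> and \<open>- a\<close> at
  \<open>v\<close>.\<close>

lemma potential_sum_uminus:
  assumes "multigraph H" "orientation H t h" "u \<in> verts H" "v \<in> verts H"
  shows "potential_sum H t h (\<lambda>x. x u = 0 \<and> x v = - a) =
    (-1) ^ card (edges H) * potential_sum H t h (\<lambda>x. x u = 0 \<and> x v = a)"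
proof -
  have th: "t e \<in> verts H" "h e \<in> verts H" if "e \<in> edges H" for e
    using assms(1,2) that by (auto simp: multigraph_def orientation_def)
  have "(\<Prod>e\<in>edges H. x (t e) - x (h e)) =
      (-1) ^ card (edges H) * (\<Prod>e\<in>edges H. (\<lambda>w\<in>verts H. - x w) (t e) - (\<lambda>w\<in>verts H. - x w) (h e))"
    for x :: "'a \<Rightarrow> 3"
    unfolding prod_constant[symmetric] prod.distrib[symmetric]
    by (intro prod.cong refl) (simp add: th)
  then show ?thesis
    unfolding potential_sum_def sum_distrib_left
    by (intro sum.reindex_bij_witness[where j = "\<lambda>x. \<lambda>w\<in>verts H. - x w" and
          i = "\<lambda>x. \<lambda>w\<in>verts H. - x w"])
      (use assms(3,4) in \<open>auto simp: fun_eq_iff PiE_def extensional_def\<close>)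
qed

text \<open>The new edge, directed from \<open>u\<close> to \<open>v\<close>, contributes the factor
  \<open>x u - x v\<close>, which is \<open>- a\<close> once potentials are grouped by
  \<open>x v = a\<close>.\<close>

lemma potential_sum_add_edge:
  assumes "multigraph H" "e \<notin> edges H"
  shows "potential_sum (add_edge H e u v) (t(e := u)) (h(e := v)) (\<lambda>x. x u = 0) =
    (\<Sum>a\<in>UNIV. - a * potential_sum H t h (\<lambda>x. x u = 0 \<and> x v = a))"
proof -
  let ?X = "{x \<in> verts H \<rightarrow>\<^sub>E (UNIV :: 3 set). x u = 0}"
  have fin: "finite (edges H)" "finite ?X"
    using assms(1) by (auto simp: multigraph_def intro: finite_subset[OF _ finite_PiE])
  have "potential_sum (add_edge H e u v) (t(e := u)) (h(e := v)) (\<lambda>x. x u = 0) =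
      (\<Sum>x\<in>?X. - x v * (\<Prod>d\<in>edges H. x (t d) - x (h d)))"
  proof -
    have "(\<Prod>d\<in>edges H. x ((t(e := u)) d) - x ((h(e := v)) d)) = (\<Prod>d\<in>edges H. x (t d) - x (h d))"
      for x :: "'a \<Rightarrow> 3"
      using assms(2) by (intro prod.cong) auto
    then show ?thesis
      using fin assms(2) by (simp add: potential_sum_def add_edge_def del: fun_upd_apply)
        (simp add: fun_upd_def)
  qed
  also have "\<dots> = (\<Sum>a\<in>UNIV. \<Sum>x\<in>{x \<in> ?X. x v = a}. - x v * (\<Prod>d\<in>edges H. x (t d) - x (h d)))"
    by (rule sum.group[symmetric]) (auto simp: fin)
  also have "\<dots> = (\<Sum>a\<in>UNIV. - a * potential_sum H t h (\<lambda>x. x u = 0 \<and> x v = a))"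
    unfolding potential_sum_def sum_distrib_left
    by (intro sum.cong) auto
  finally show ?thesis .
qed

text \<open>Only \<open>u\<close> and \<open>v\<close> are shared, so once their values are
  prescribed a potential on the union is an independent pair of potentials on the parts, and the
  edge product splits accordingly.\<close>

lemma potential_sum_union:
  assumes H1: "multigraph H1" "orientation H1 t1 h1" and H2: "multigraph H2" "orientation H2 t2 h2"
    and V: "verts H1 \<inter> verts H2 = {u, v}" and E: "edges H1 \<inter> edges H2 = {}"
  shows "potential_sum (graph_union H1 H2) (\<lambda>e. if e \<in> edges H1 then t1 e else t2 e)
      (\<lambda>e. if e \<in> edges H1 then h1 e else h2 e) (\<lambda>x. x u = 0) =
    (\<Sum>a\<in>UNIV. potential_sum H1 t1 h1 (\<lambda>x. x u = 0 \<and> x v = a) *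
      potential_sum H2 t2 h2 (\<lambda>x. x u = 0 \<and> x v = a))"
proof -
  define X where "X W a = {x \<in> W \<rightarrow>\<^sub>E (UNIV :: 3 set). x u = 0 \<and> x v = a}" for W a
  define p1 :: "('a \<Rightarrow> 3) \<Rightarrow> 3" where "p1 x = (\<Prod>e\<in>edges H1. x (t1 e) - x (h1 e))" for x
  define p2 :: "('a \<Rightarrow> 3) \<Rightarrow> 3" where "p2 x = (\<Prod>e\<in>edges H2. x (t2 e) - x (h2 e))" for x
  let ?V = "verts H1 \<union> verts H2"
  let ?X = "{x \<in> ?V \<rightarrow>\<^sub>E (UNIV :: 3 set). x u = 0}"
  have fin: "finite (edges H1)" "finite (edges H2)" "finite ?X"
    using H1(1) H2(1) by (auto simp: multigraph_def intro!: finite_subset[OF _ finite_PiE, of _ ?V])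
  have th1: "t1 e \<in> verts H1" "h1 e \<in> verts H1" if "e \<in> edges H1" for e
    using H1 that by (auto simp: multigraph_def orientation_def)
  have th2: "t2 e \<in> verts H2" "h2 e \<in> verts H2" if "e \<in> edges H2" for e
    using H2 that by (auto simp: multigraph_def orientation_def)
  have p1_restrict: "p1 (restrict x (verts H1)) = p1 x" for x
    unfolding p1_def by (intro prod.cong) (simp_all add: th1)
  have p2_restrict: "p2 (restrict x (verts H2)) = p2 x" for x
    unfolding p2_def by (intro prod.cong) (simp_all add: th2)
  have glue: "(\<Sum>x\<in>X ?V a. p1 x * p2 x) = (\<Sum>x\<in>X (verts H1) a. p1 x) * (\<Sum>x\<in>X (verts H2) a. p2 x)" for a
  proof -
    have "(\<Sum>x\<in>X ?V a. p1 x * p2 x) = (\<Sum>(x, y)\<in>X (verts H1) a \<times> X (verts H2) a. p1 x * p2 y)"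
    proof (rule sum.reindex_bij_witness[where j = "\<lambda>x. (restrict x (verts H1), restrict x (verts H2))" and
        i = "\<lambda>(x, y). \<lambda>w\<in>?V. if w \<in> verts H1 then x w else y w"], goal_cases)
      case (3 z)
      obtain x y where z: "z = (x, y)" "x \<in> X (verts H1) a" "y \<in> X (verts H2) a"
        using 3 by auto
      \<comment> \<open>The glued function takes its shared values from \<open>x\<close>, so
        recovering \<open>y\<close> requires agreement there.\<close>
      have "x w = y w" if "w \<in> verts H1" "w \<in> verts H2" for w
      proof -
        have "w = u \<or> w = v" using V that by blast
        then show ?thesis using z by (auto simp: X_def)
      qed
      then show ?case
        using z by (auto simp: X_def fun_eq_iff PiE_def extensional_def)
    qed (use V in \<open>auto simp: X_def fun_eq_iff PiE_def extensional_def p1_restrict p2_restrict\<close>)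
    then show ?thesis by (simp add: sum_product sum.cartesian_product)
  qed
  have "potential_sum (graph_union H1 H2) (\<lambda>e. if e \<in> edges H1 then t1 e else t2 e)
      (\<lambda>e. if e \<in> edges H1 then h1 e else h2 e) (\<lambda>x. x u = 0) = (\<Sum>x\<in>?X. p1 x * p2 x)"
  proof -
    have "(\<Prod>e\<in>edges H1 \<union> edges H2. x (if e \<in> edges H1 then t1 e else t2 e) -
        x (if e \<in> edges H1 then h1 e else h2 e)) = p1 x * p2 x" for x
    proof -
      have "e \<notin> edges H1" if "e \<in> edges H2" for e using that E by blast
      then show ?thesis
        unfolding p1_def p2_def prod.union_disjoint[OF fin(1,2) E]
        by (intro arg_cong2[where f = "(*)"] prod.cong) auto
    qed
    then show ?thesis by (simp add: potential_sum_def graph_union_def)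
  qed
  also have "\<dots> = (\<Sum>a\<in>UNIV. \<Sum>x\<in>{x \<in> ?X. x v = a}. p1 x * p2 x)"
    by (rule sum.group[symmetric]) (auto simp: fin)
  also have "\<dots> = (\<Sum>a\<in>UNIV. \<Sum>x\<in>X ?V a. p1 x * p2 x)"
    by (intro sum.cong) (auto simp: X_def)
  finally show ?thesis
    unfolding glue by (simp add: potential_sum_def X_def p1_def p2_def)
qed

lemma potential_sum_odd:
  assumes H: "multigraph H" "orientation H t h" and uv: "u \<in> verts H" "v \<in> verts H"
    and odd: "odd (card (edges H))" and e: "e \<notin> edges H"
  defines "F \<equiv> \<lambda>a. potential_sum H t h (\<lambda>x. x u = 0 \<and> x v = a)"
  shows "F 0 = 0" "F 2 = - F 1"
    "potential_sum (add_edge H e u v) (t(e := u)) (h(e := v)) (\<lambda>x. x u = 0) = F 1"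
proof -
  \<comment> \<open>Negating all potentials changes the sign of each of the oddly many factors.\<close>
  have minus: "F (- a) = - F a" for a
    unfolding F_def using potential_sum_uminus[OF H uv] odd by simp
  \<comment> \<open>\<open>F 0 = - F 0\<close> forces 0 because 2 is invertible modulo 3.\<close>
  show F0: "F 0 = 0"
    using minus[of 0] mod3_cases[of "F 0"] by auto
  have two: "(2 :: 3) = - 1" by simp
  show F2: "F 2 = - F 1"
    unfolding two by (rule minus)
  have "potential_sum (add_edge H e u v) (t(e := u)) (h(e := v)) (\<lambda>x. x u = 0) =
      (\<Sum>a\<in>{0, 1, 2}. - a * F a)"
    unfolding potential_sum_add_edge[OF H(1) e] F_def UNIV_mod3 ..
  \<comment> \<open>The terms are 0, \<open>- F 1\<close> and
    \<open>- 2 * F 2 = 2 * F 1\<close>.\<close>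
  also have "\<dots> = F 1"
    by (simp add: F2)
  finally show "potential_sum (add_edge H e u v) (t(e := u)) (h(e := v)) (\<lambda>x. x u = 0) = F 1" .
qed

section \<open>Well-formedness of the composed graphs and the product formula\<close>

lemma multigraph_add_edge:
  assumes "multigraph H" "u \<in> verts H" "v \<in> verts H"
  shows "multigraph (add_edge H e u v)"
proof -
  have "card {u, v} \<in> {1, 2}" by (simp add: card_insert_if)
  then show ?thesis using assms by (simp add: multigraph_def add_edge_def)
qed

lemma multigraph_union:
  assumes "multigraph H" "multigraph K"
  shows "multigraph (graph_union H K)"
  using assms unfolding multigraph_def graph_union_def by (simp add: ball_Un) blast

theorem theorem4p8:
  fixes H1 H2 G G1 G2 :: "('v, 'e) mgraph"
    and v1 v2 :: 'v and e1 e2 :: 'e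
  assumes "multigraph H1" and "loopless H1"
    and "multigraph H2" and "loopless H2"
    and "v1 \<noteq> v2" and "verts H1 \<inter> verts H2 = {v1, v2}"
    and "edges H1 \<inter> edges H2 = {}"
    and "G = graph_union H1 H2"
    and "e1 \<notin> edges H1" and "G1 = add_edge H1 e1 v1 v2"
    and "e2 \<notin> edges H2" and "G2 = add_edge H2 e2 v1 v2"
    and "\<And>G'. G' \<in> {G, G1, G2} \<Longrightarrow>
           connected_mgraph G' \<and> 2 * card (verts G') = card (edges G') + 2"
  shows "[graph_permanent G = graph_permanent G1 * graph_permanent G2] (mod 3)"
proof -
  have v: "v1 \<in> verts H1" "v2 \<in> verts H1" "v1 \<in> verts H2" "v2 \<in> verts H2"
    using assms(6) by auto
  obtain t1 h1 where o1: "orientation H1 t1 h1"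
    using ex_orientation[OF assms(1)] .
  obtain t2 h2 where o2: "orientation H2 t2 h2"
    using ex_orientation[OF assms(3)] .
  define F1 where "F1 a = potential_sum H1 t1 h1 (\<lambda>x. x v1 = 0 \<and> x v2 = a)" for a
  define F2 where "F2 a = potential_sum H2 t2 h2 (\<lambda>x. x v1 = 0 \<and> x v2 = a)" for a
  have card: "2 * card (verts G') = card (edges G') + 2" if "G' \<in> {G, G1, G2}" for G'
    using assms(13)[OF that] by simp
  have fin: "finite (edges H1)" "finite (edges H2)"
    using assms(1,3) by (auto simp: multigraph_def)
  \<comment> \<open>The edge count of each \<open>H\<close>-part is that of its augmented graph
    minus one, hence twice the vertex count minus 3, which is odd.\<close>
  have "2 * card (verts H1) = card (edges H1) + 3" "2 * card (verts H2) = card (edges H2) + 3"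
    using card[of G1] card[of G2] fin assms(9-12) by (auto simp: add_edge_def)
  then have odd: "odd (card (edges H1))" "odd (card (edges H2))"
    by presburger+
  note F1 = potential_sum_odd[OF assms(1) o1 v(1,2) odd(1) assms(9), folded F1_def assms(10)]
  note F2 = potential_sum_odd[OF assms(3) o2 v(3,4) odd(2) assms(11), folded F2_def assms(12)]
  \<comment> \<open>\<open>v1\<close> is the special vertex in all three graphs, and each new edge
    is directed from \<open>v1\<close> to \<open>v2\<close>.\<close>
  have G1: "(of_int (graph_permanent G1) :: 3) = (F1 1)\<^sup>2"
    unfolding F1(3)[symmetric]
  proof (rule graph_permanent_mod3)
    show "multigraph G1" unfolding assms(10) using assms(1) v by (intro multigraph_add_edge)
    show "loopless G1" using assms(2,5,9) by (auto simp: assms(10) loopless_def add_edge_def)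
    show "orientation G1 (t1(e1 := v1)) (h1(e1 := v2))"
      using o1 assms(9) by (auto simp: assms(10) orientation_def add_edge_def)
  qed (use card[of G1] v in \<open>simp_all add: assms(10) add_edge_def\<close>)
  have G2: "(of_int (graph_permanent G2) :: 3) = (F2 1)\<^sup>2"
    unfolding F2(3)[symmetric]
  proof (rule graph_permanent_mod3)
    show "multigraph G2" unfolding assms(12) using assms(3) v by (intro multigraph_add_edge)
    show "loopless G2" using assms(4,5,11) by (auto simp: assms(12) loopless_def add_edge_def)
    show "orientation G2 (t2(e2 := v1)) (h2(e2 := v2))"
      using o2 assms(11) by (auto simp: assms(12) orientation_def add_edge_def)
  qed (use card[of G2] v in \<open>simp_all add: assms(12) add_edge_def\<close>)
  let ?t = "\<lambda>e. if e \<in> edges H1 then t1 e else t2 e"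
  let ?h = "\<lambda>e. if e \<in> edges H1 then h1 e else h2 e"
  have "(of_int (graph_permanent G) :: 3) = (potential_sum G ?t ?h (\<lambda>x. x v1 = 0))\<^sup>2"
  proof (rule graph_permanent_mod3)
    show "multigraph G" unfolding assms(8) using assms(1,3) by (rule multigraph_union)
    show "loopless G" using assms(2,4) by (auto simp: assms(8) loopless_def graph_union_def)
    show "orientation G ?t ?h"
      using o1 o2 by (auto simp: assms(8) orientation_def graph_union_def)
  qed (use card[of G] v in \<open>simp_all add: assms(8) graph_union_def\<close>)
  also have "potential_sum G ?t ?h (\<lambda>x. x v1 = 0) = (\<Sum>a\<in>{0, 1, 2}. F1 a * F2 a)"
    unfolding assms(8) potential_sum_union[OF assms(1) o1 assms(3) o2 assms(6,7)] F1_def F2_def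
      UNIV_mod3 ..
  \<comment> \<open>The term for 0 vanishes; those for 1 and 2 agree because both factors change
    sign, and 2 is -1 in \<open>3\<close>. The sign disappears on squaring.\<close>
  also have "\<dots> = - (F1 1 * F2 1)"
    using mod3_cases[of "F1 1 * F2 1"] by (auto simp: F1(1,2) F2(1,2))
  finally have "(of_int (graph_permanent G) :: 3) = of_int (graph_permanent G1 * graph_permanent G2)"
    by (simp add: G1 G2 power_mult_distrib)
  then show ?thesis
    by (simp only: of_int_mod3_eq_iff)
qed

end
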